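(* Let $n\ge 1$ be an integer, let $\mathcal{H}$ be a complex Hilbert space, and let $f\in\mathcal{D}(\mathbb{D}^n,\mathcal{H})$. Then for quasi-every $\theta$ the limit $$f^\ast(\theta)=\lim_{r\to(1,\dots,1)}f_r(\theta)$$ (taken over $r\in[0,1)^n$, in the norm of $\mathcal{H}$, without restriction on the relationship between the $r_j$) exists, and furthermore $$\sup_{r\in[0,1)^n}\|f_r(\theta)\|_{\mathcal{H}}<\infty.$$ The value of $f^\ast(\theta)$ coincides with the Pringsheim sum $f(\theta)$ for quasi-every $\theta$.
   Context: Notation: $\mathbb{N}=\{0,1,2,\dots\}$; $(\alpha,\theta)=\alpha_1\theta_1+\cdots+\alpha_n\theta_n$; $r^\alpha=r_1^{\alpha_1}\cdots r_n^{\alpha_n}$. The set $[0,2\pi)^n$ is identified with the $n$-torus $\mathbb{T}^n$ via $\theta\mapsto(e^{i\theta_1},\dots,e^{i\theta_n})$, and $d\psi$ denotes normalized Lebesgue measure on $\mathbb{T}^n$. Dirichlet space: a multiple Fourier series $f(\theta)\sim\sum_{\alpha\in\mathbb{N}^n}a_\alpha e^{i(\alpha,\theta)}$ with coefficients $a_\alpha\in\mathcal{H}$ belongs to $\mathcal{D}(\mathbb{D}^n,\mathcal{H})$ if $\sum_{\alpha\in\mathbb{N}^n}(\alpha_1+1)\cdots(\alpha_n+1)\|a_\alpha\|_{\mathcal{H}}^2<\infty$. For $r\in[0,1)^n$, $f_r(\theta)=\sum_{\alpha\in\mathbb{N}^n}a_\alpha r^\alpha e^{i(\alpha,\theta)}$.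 Capacity: for a positive measurable function $g$ on $\mathbb{T}^n$ let $$Bg(\theta)=\int_{\mathbb{T}^n}\frac{1}{|e^{i\theta_1}-e^{i\psi_1}|^{1/2}}\cdots\frac{1}{|e^{i\theta_n}-e^{i\psi_n}|^{1/2}}\,g(\psi)\,d\psi\in[0,\infty].$$ For a set $E\subset\mathbb{T}^n$ let $C(E)=\inf\{\|g\|_{L^2(\mathbb{T}^n)}^2 : g\ge 0,\ Bg(\theta)\ge 1 \text{ for all } \theta\in E\}$. A property holds quasi-everywhere (for quasi-every $\theta$) if it holds for all $\theta\in\mathbb{T}^n$ outside a set $E$ with $C(E)=0$. Pringsheim sum: the series $f(\theta)$ converges in the sense of Pringsheim (at the given $\theta$) if the rectangular partial sums $\sum_{\alpha_1=0}^{N_1}\cdots\sum_{\alpha_n=0}^{N_n}a_\alpha e^{i(\alpha,\theta)}$ converge in $\mathcal{H}$ as $N\in\mathbb{N}^n$, $\min_{1\le j\le n}N_j\to\infty$ (no assumption on the relationship between the $N_j$), and the partial sums are bounded in $\mathcal{H}$ uniformly over $N\in\mathbb{N}^n$. The limit is then the Pringsheim sum, denoted $f(\theta)$. The last assertion of the claim means that for quasi-every $\theta$ the Pringsheim sum $f(\theta)$ exists and equals $f^\ast(\theta)$. *)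

theory Defs
  imports "HOL-Analysis.Analysis"
begin

text \<open>The inner product is linear in its first argument; the norm it induces is the ambient one.\<close>

class complex_hilbert_space = banach +
  fixes scaleC :: "complex \<Rightarrow> 'a \<Rightarrow> 'a" (infixr "*\<^sub>C" 75)
    and cinner :: "'a \<Rightarrow> 'a \<Rightarrow> complex"
  assumes scaleC_add_right: "c *\<^sub>C (x + y) = c *\<^sub>C x + c *\<^sub>C y"
    and scaleC_add_left: "(c + d) *\<^sub>C x = c *\<^sub>C x + d *\<^sub>C x"
    and scaleC_scaleC: "c *\<^sub>C (d *\<^sub>C x) = (c * d) *\<^sub>C x"
    and scaleC_of_real: "complex_of_real t *\<^sub>C x = t *\<^sub>R x"
    and cinner_add_left: "cinner (x + y) z = cinner x z + cinner y z"
    and cinner_scaleC_left: "cinner (c *\<^sub>C x) y = c * cinner x y"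
    and cinner_commute: "cinner x y = cnj (cinner y x)"
    and cinner_self: "cinner x x = complex_of_real ((norm x)\<^sup>2)"

instantiation complex :: complex_hilbert_space
begin

definition scaleC_complex :: "complex \<Rightarrow> complex \<Rightarrow> complex"
  where "scaleC_complex c x = c * x"

definition cinner_complex :: "complex \<Rightarrow> complex \<Rightarrow> complex"
  where "cinner_complex x y = x * cnj y"

instance
  by standard
    (simp_all add: scaleC_complex_def cinner_complex_def algebra_simps scaleR_conv_of_real
      complex_norm_square del: of_real_power)

end

definition torus :: "(real ^ 'n) set"
  where "torus = {\<theta>. \<forall>j. 0 \<le> \<theta> $ j \<and> \<theta> $ j < 2 * pi}"

text \<open>A measure on the whole of the vector space, concentrated on \<open>torus\<close>; values of integrands
  off \<open>torus\<close> are irrelevant.\<close>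

definition torus_measure :: "(real ^ 'n) measure"
  where "torus_measure = uniform_measure lebesgue torus"

text \<open>In \<open>ennreal\<close>, \<open>1 / 0 = \<infinity>\<close>, so the kernel is infinite on its singular set.\<close>

definition potential :: "(real ^ 'n \<Rightarrow> ennreal) \<Rightarrow> real ^ 'n \<Rightarrow> ennreal"
  where "potential g \<theta> =
    (\<integral>\<^sup>+ \<psi>. (\<Prod>j\<in>UNIV. 1 / ennreal (cmod (cis (\<theta> $ j) - cis (\<psi> $ j)) powr (1 / 2))) * g \<psi>
      \<partial>torus_measure)"

definition capacity :: "(real ^ 'n) set \<Rightarrow> ennreal"
  where "capacity E =
    (INF g \<in> {g \<in> borel_measurable torus_measure. \<forall>\<theta>\<in>E. 1 \<le> potential g \<theta>}.
      \<integral>\<^sup>+ \<psi>. (g \<psi>)\<^sup>2 \<partial>torus_measure)"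

definition quasi_everywhere :: "(real ^ 'n \<Rightarrow> bool) \<Rightarrow> bool"
  where "quasi_everywhere P \<longleftrightarrow> (\<exists>E\<subseteq>torus. capacity E = 0 \<and> (\<forall>\<theta>\<in>torus - E. P \<theta>))"

text \<open>A multiple Fourier series is represented by its family of coefficients.\<close>

definition dirichlet_space :: "(('n::finite \<Rightarrow> nat) \<Rightarrow> 'h::complex_hilbert_space) set"
  where "dirichlet_space =
    {a. (\<lambda>\<alpha>. (\<Prod>j\<in>UNIV. real (\<alpha> j) + 1) * (norm (a \<alpha>))\<^sup>2) summable_on UNIV}"

definition character :: "('n::finite \<Rightarrow> nat) \<Rightarrow> real ^ 'n \<Rightarrow> complex"
  where "character \<alpha> \<theta> = cis (\<Sum>j\<in>UNIV. real (\<alpha> j) * \<theta> $ j)"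

definition radii :: "(real ^ 'n) set"
  where "radii = {r. \<forall>j. 0 \<le> r $ j \<and> r $ j < 1}"

definition dilation ::
  "(('n::finite \<Rightarrow> nat) \<Rightarrow> 'h::complex_hilbert_space) \<Rightarrow> real ^ 'n \<Rightarrow> real ^ 'n \<Rightarrow> 'h"
  where "dilation a r \<theta> =
    (\<Sum>\<^sub>\<infinity>\<alpha>. (complex_of_real (\<Prod>j\<in>UNIV. (r $ j) ^ \<alpha> j) * character \<alpha> \<theta>) *\<^sub>C a \<alpha>)"

text \<open>For a Dirichlet series the family summed in \<open>dilation\<close> is summable, so that the default
  value of \<open>infsum\<close> plays no role.\<close>

lemma norm_scaleC: "norm (c *\<^sub>C x) = cmod c * norm x"
proof -
  have "complex_of_real ((norm (c *\<^sub>C x))\<^sup>2) = c * cnj (c * cinner x x)"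
    by (metis cinner_commute cinner_scaleC_left cinner_self)
  also have "\<dots> = complex_of_real ((cmod c * norm x)\<^sup>2)"
    by (simp add: cinner_self power_mult_distrib complex_norm_square del: of_real_power)
  finally have "(norm (c *\<^sub>C x))\<^sup>2 = (cmod c * norm x)\<^sup>2"
    using of_real_eq_iff by blast
  then show ?thesis by simp
qed

lemma dilation_summable:
  fixes a :: "('n::finite \<Rightarrow> nat) \<Rightarrow> 'h::complex_hilbert_space"
  assumes a: "a \<in> dirichlet_space" and r: "r \<in> radii"
  shows "(\<lambda>\<alpha>. (complex_of_real (\<Prod>j\<in>UNIV. (r $ j) ^ \<alpha> j) * character \<alpha> \<theta>) *\<^sub>C a \<alpha>)
    summable_on UNIV"
proof -
  define w where "w = (\<lambda>\<alpha>::'n \<Rightarrow> nat. (\<Prod>j\<in>UNIV. real (\<alpha> j) + 1))"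
  define C where "C = (\<Sum>\<^sub>\<infinity>\<alpha>. w \<alpha> * (norm (a \<alpha>))\<^sup>2)"
  have w1: "1 \<le> w \<alpha>" for \<alpha>
    unfolding w_def by (rule prod_ge_1) simp
  have bound: "norm (a \<alpha>) \<le> sqrt C" for \<alpha>
  proof -
    have "(norm (a \<alpha>))\<^sup>2 \<le> w \<alpha> * (norm (a \<alpha>))\<^sup>2"
      using w1[of \<alpha>] by (simp add: mult_le_cancel_right1)
    also have "\<dots> = (\<Sum>\<^sub>\<infinity>\<beta>\<in>{\<alpha>}. w \<beta> * (norm (a \<beta>))\<^sup>2)"
      by simp
    also have "\<dots> \<le> C"
      unfolding C_def
    proof (rule infsum_mono_neutral)
      show "(\<lambda>\<beta>. w \<beta> * (norm (a \<beta>))\<^sup>2) summable_on UNIV"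
        using a by (simp add: dirichlet_space_def w_def)
    next
      fix \<beta> show "0 \<le> w \<beta> * (norm (a \<beta>))\<^sup>2"
        using w1[of \<beta>] by (intro mult_nonneg_nonneg) auto
    qed simp_all
    finally show ?thesis by (rule real_le_rsqrt)
  qed
  have "Infinite_Set_Sum.abs_summable_on (\<lambda>g. \<Prod>j\<in>UNIV. (r $ j) ^ g j)
      (Pi\<^sub>E (UNIV::'n set) (\<lambda>_. UNIV::nat set))"
    using r by (intro abs_summable_on_prod_PiE) (auto simp: abs_summable_on_nat_iff' radii_def)
  then have "(\<lambda>\<alpha>::'n \<Rightarrow> nat. norm (\<Prod>j\<in>UNIV. (r $ j) ^ \<alpha> j)) summable_on UNIV"
    by (simp only: abs_summable_equivalent[symmetric] PiE_UNIV_domain)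
      (simp add: Pi_def)
  then have "(\<lambda>\<alpha>::'n \<Rightarrow> nat. norm (\<Prod>j\<in>UNIV. (r $ j) ^ \<alpha> j) * sqrt C) summable_on UNIV"
    by (rule summable_on_cmult_left)
  then have "(\<lambda>\<alpha>. norm ((complex_of_real (\<Prod>j\<in>UNIV. (r $ j) ^ \<alpha> j) * character \<alpha> \<theta>) *\<^sub>C a \<alpha>))
      summable_on UNIV"
    by (rule summable_on_comparison_test)
      (simp_all add: norm_scaleC norm_mult character_def mult_left_mono bound del: of_real_prod)
  then show ?thesis by (rule abs_summable_summable)
qed

definition rect_partial_sum ::
  "(('n::finite \<Rightarrow> nat) \<Rightarrow> 'h::complex_hilbert_space) \<Rightarrow> real ^ 'n \<Rightarrow> ('n \<Rightarrow> nat) \<Rightarrow> 'h"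
  where "rect_partial_sum a \<theta> N = (\<Sum>\<alpha> | \<forall>j. \<alpha> j \<le> N j. character \<alpha> \<theta> *\<^sub>C a \<alpha>)"

text \<open>The filter expresses that \<open>min\<^sub>j N\<^sub>j \<rightarrow> \<infinity>\<close>.\<close>

definition has_pringsheim_sum ::
  "(('n::finite \<Rightarrow> nat) \<Rightarrow> 'h::complex_hilbert_space) \<Rightarrow> real ^ 'n \<Rightarrow> 'h \<Rightarrow> bool"
  where "has_pringsheim_sum a \<theta> s \<longleftrightarrow>
    (rect_partial_sum a \<theta> \<longlongrightarrow> s) (filtercomap (\<lambda>N. MIN j. N j) at_top) \<and>
    bounded (range (rect_partial_sum a \<theta>))"

end

theory Submission
  imports Defs
begin

text \<open>A Dirichlet series is, formally, the convolution of the square integrable function with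
  coefficients \<open>\<Prod>\<^sub>j (\<alpha>\<^sub>j + 1)\<^sup>1\<^sup>/\<^sup>2 a\<^sub>\<alpha>\<close> with the product of the kernels
  \<open>\<Sum>\<^sub>k (k + 1)\<^sup>-\<^sup>1\<^sup>/\<^sup>2 z\<^sup>k\<close>. Multiplying the coefficients of such a kernel by any decreasing
  sequence in \<open>[0, 1]\<close>, for instance by \<open>r\<^sup>k\<close> or by the indicator of \<open>k \<le> N\<close>, leaves it bounded
  by \<open>4 \<bar>z - 1\<bar>\<^sup>-\<^sup>1\<^sup>/\<^sup>2\<close>. So all the dilations and all the rectangular partial sums of a
  trigonometric polynomial are dominated, uniformly, by the potential of one function, and no
  maximal function is needed. Splitting the series into finite blocks of rapidly decreasing energy,
  the sum of these potentials is finite off a set of capacity zero, and there both limits exist by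
  dominated convergence of the sum over the blocks. The two limits agree because both are the sum
  of the complete blocks.\<close>

section \<open>Complex Hilbert spaces\<close>

lemma bounded_linear_scaleC_left: "bounded_linear (\<lambda>c. c *\<^sub>C (x::'h::complex_hilbert_space))"
proof (rule bounded_linear_intro[where K = "norm x"])
  fix r c
  show "(r *\<^sub>R c) *\<^sub>C x = r *\<^sub>R (c *\<^sub>C x)"
    by (metis scaleC_of_real scaleC_scaleC scaleR_conv_of_real)
qed (simp_all add: scaleC_add_left norm_scaleC)

lemma scaleC_zero_left [simp]: "0 *\<^sub>C (x::'h::complex_hilbert_space) = 0"
  using linear_0[OF bounded_linear.linear[OF bounded_linear_scaleC_left]] .

lemma cinner_zero_left [simp]: "cinner 0 (y::'h::complex_hilbert_space) = 0"
  using cinner_add_left[of 0 0 y] by simp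

lemma cinner_zero_right [simp]: "cinner (x::'h::complex_hilbert_space) 0 = 0"
  by (subst cinner_commute) simp

lemma cinner_add_right:
  "cinner (x::'h::complex_hilbert_space) (y + z) = cinner x y + cinner x z"
  by (metis cinner_add_left cinner_commute complex_cnj_add)

lemma cinner_scaleC_right:
  "cinner (x::'h::complex_hilbert_space) (c *\<^sub>C y) = cnj c * cinner x y"
  by (metis cinner_commute cinner_scaleC_left complex_cnj_mult)

lemma cinner_sum_left:
  "cinner (\<Sum>i\<in>A. f i) (y::'h::complex_hilbert_space) = (\<Sum>i\<in>A. cinner (f i) y)"
  by (induction A rule: infinite_finite_induct) (simp_all add: cinner_add_left)

lemma cinner_sum_right:
  "cinner (x::'h::complex_hilbert_space) (\<Sum>i\<in>A. f i) = (\<Sum>i\<in>A. cinner x (f i))"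
  by (induction A rule: infinite_finite_induct) (simp_all add: cinner_add_right)

lemma norm_cinner_le: "cmod (cinner x y) \<le> norm x * norm (y::'h::complex_hilbert_space)"
proof (cases "y = 0")
  case False
  define p where "p = (norm y)\<^sup>2"
  define q where "q = cinner x y"
  \<comment> \<open>\<open>v\<close> is \<open>(norm y)\<^sup>2\<close> times the component of
    \<open>x\<close> orthogonal to \<open>y\<close>. Scaling avoids a division, and
    \<open>0 \<le> (norm v)\<^sup>2\<close> is the claim up to a positive factor.\<close>
  define v where "v = complex_of_real p *\<^sub>C x + (- q) *\<^sub>C y"
  have yx: "cinner y x = cnj q"
    unfolding q_def by (rule cinner_commute)
  have xx: "cinner x x = complex_of_real ((norm x)\<^sup>2)" and yy: "cinner y y = complex_of_real p"
    unfolding p_def by (rule cinner_self)+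
  have p: "p > 0"
    using False by (simp add: p_def)
  have "cinner v v = complex_of_real p * (complex_of_real p * complex_of_real ((norm x)\<^sup>2) - q * cnj q)"
    unfolding v_def
    by (simp add: cinner_add_left cinner_add_right cinner_scaleC_left cinner_scaleC_right
        yx q_def[symmetric] xx yy algebra_simps del: of_real_power)
  also have "\<dots> = complex_of_real (p * (p * (norm x)\<^sup>2 - (cmod q)\<^sup>2))"
    by (simp add: complex_norm_square[symmetric])
  finally have "(norm v)\<^sup>2 = p * (p * (norm x)\<^sup>2 - (cmod q)\<^sup>2)"
    unfolding cinner_self of_real_eq_iff .
  then have "0 \<le> p * (p * (norm x)\<^sup>2 - (cmod q)\<^sup>2)"
    by (metis zero_le_power2)
  then have "(cmod q)\<^sup>2 \<le> (norm x * norm y)\<^sup>2"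
    using p by (simp add: zero_le_mult_iff p_def power_mult_distrib mult.commute)
  then show ?thesis
    unfolding q_def by (rule power2_le_imp_le) simp
qed simp

section \<open>A kernel estimate\<close>

text \<open>Summation by parts: the partial sums of \<open>u\<close> receive the nonnegative weights
  \<open>c n\<close> and \<open>c k - c (Suc k)\<close>, which add up to \<open>c 0\<close>.\<close>

lemma norm_sum_antimono_le:
  fixes u :: "nat \<Rightarrow> 'a::real_normed_vector"
  assumes c: "antimono c" "\<And>k. 0 \<le> c k"
    and u: "\<And>m. norm (\<Sum>k<m. u k) \<le> K"
  shows "norm (\<Sum>k<n. c k *\<^sub>R u k) \<le> K * c 0"
proof -
  define U where "U m = (\<Sum>k<m. u k)" for m
  have "(\<Sum>k<n. c k *\<^sub>R u k) = c n *\<^sub>R U n + (\<Sum>k<n. (c k - c (Suc k)) *\<^sub>R U (Suc k))"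
    by (induction n) (simp_all add: U_def algebra_simps)
  also have "norm \<dots> \<le> c n * K + (\<Sum>k<n. (c k - c (Suc k)) * K)"
  proof (intro norm_triangle_le add_mono order_trans[OF norm_sum sum_mono])
    show "norm (c n *\<^sub>R U n) \<le> c n * K"
      using c u by (simp add: U_def mult_left_mono)
    fix k
    have "0 \<le> c k - c (Suc k)"
      using c(1) by (simp add: antimono_def)
    then show "norm ((c k - c (Suc k)) *\<^sub>R U (Suc k)) \<le> (c k - c (Suc k)) * K"
      using u unfolding norm_scaleR U_def by (simp add: mult_left_mono del: sum.lessThan_Suc)
  qed
  also have "(\<Sum>k<n. (c k - c (Suc k)) * K) = (c 0 - c n) * K"
    by (simp add: sum_distrib_right[symmetric] sum_lessThan_telescope')
  finally show ?thesis
    by (simp add: algebra_simps)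
qed

lemma sum_inverse_sqrt_le: "(\<Sum>k<n. 1 / sqrt (real k + 1)) \<le> 2 * sqrt (real n)"
proof (induction n)
  case (Suc n)
  define s t where "s = sqrt (real n)" and "t = sqrt (real n + 1)"
  have t: "t > 0" "t\<^sup>2 = s\<^sup>2 + 1"
    by (simp_all add: s_def t_def)
  \<comment> \<open>By \<open>t\<^sup>2 = s\<^sup>2 + 1\<close> this square equals
    \<open>2 * t * (t - s) - 1\<close>, so the new term \<open>1 / t\<close> is at most the
    increment of the right-hand side.\<close>
  have "0 \<le> (t - s)\<^sup>2"
    by simp
  then have "1 \<le> (2 * t - 2 * s) * t"
    using t(2) by (simp add: power2_eq_square algebra_simps)
  then have "1 / t \<le> 2 * t - 2 * s"
    using t(1) by (simp add: field_simps)
  then show ?case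
    using Suc by (simp add: s_def t_def add.commute)
qed simp

text \<open>A geometric sum. The exponents start at \<open>l\<close> so that it fits the tail of the
  kernel; the shift only contributes a factor of modulus one.\<close>

lemma norm_sum_power_le:
  assumes "cmod z = 1" "z \<noteq> 1"
  shows "cmod (\<Sum>k<m. z ^ (l + k)) \<le> 2 / cmod (z - 1)"
proof -
  have "cmod (\<Sum>k<m. z ^ (l + k)) = cmod (\<Sum>k<m. z ^ k)"
    using assms(1) by (simp add: power_add sum_distrib_left[symmetric] norm_mult norm_power)
  also have "\<dots> = cmod (z ^ m - 1) / cmod (z - 1)"
    using assms(2) by (simp add: sum_gp_strict norm_divide norm_minus_commute)
  also have "\<dots> \<le> 2 / cmod (z - 1)"
    using norm_triangle_ineq4[of "z ^ m" 1] assms(1)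
    by (intro divide_right_mono) (simp_all add: norm_power)
  finally show ?thesis .
qed

text \<open>The sum is split at \<open>1 / \<bar>z - 1\<bar>\<close>: the first part is estimated trivially, the second one by
  partial summation.\<close>

lemma kernel_bound:
  fixes \<rho> :: "nat \<Rightarrow> real"
  assumes \<rho>: "antimono \<rho>" "\<And>k. 0 \<le> \<rho> k" "\<And>k. \<rho> k \<le> 1"
    and z: "cmod z = 1" "z \<noteq> 1"
  shows "cmod (\<Sum>k<n. complex_of_real (\<rho> k / sqrt (real k + 1)) * z ^ k)
    \<le> 4 / cmod (z - 1) powr (1 / 2)"
proof -
  define d where "d = cmod (z - 1)"
  define c where "c k = \<rho> k / sqrt (real k + 1)" for k
  \<comment> \<open>The two parts balance here: \<open>l \<le> 1 / d\<close> turns the trivial bound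
    \<open>2 * sqrt l\<close> into \<open>2 / sqrt d\<close>, and \<open>1 / d \<le> l + 1\<close>
    makes the leading tail coefficient \<open>c l\<close> at most \<open>sqrt d\<close>, which
    reduces \<open>2 / d\<close> to \<open>2 / sqrt d\<close>.\<close>
  define l where "l = nat \<lfloor>1 / d\<rfloor>"
  have d: "d > 0"
    using z by (simp add: d_def)
  have l: "real l \<le> 1 / d" "1 / d \<le> real l + 1"
    using d unfolding l_def by (auto simp: of_nat_nat)
  have c0: "0 \<le> c k" for k
    using \<rho> by (simp add: c_def)
  have c1: "c k \<le> 1 / sqrt (real k + 1)" for k
    using \<rho> by (simp add: c_def divide_right_mono)
  have c_anti: "antimono c"
    unfolding c_def using \<rho> by (intro antimonoI frac_le) (auto dest: antimonoD)
  have first: "cmod (\<Sum>k<m. complex_of_real (c k) * z ^ k) \<le> 2 * sqrt (real l)" if "m \<le> l" for m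
  proof -
    have "cmod (\<Sum>k<m. complex_of_real (c k) * z ^ k) \<le> (\<Sum>k<m. c k)"
      using c0 z by (intro order_trans[OF norm_sum sum_mono]) (simp add: norm_mult norm_power)
    also have "\<dots> \<le> (\<Sum>k<m. 1 / sqrt (real k + 1))"
      by (intro sum_mono c1)
    also have "\<dots> \<le> 2 * sqrt (real m)"
      by (rule sum_inverse_sqrt_le)
    also have "\<dots> \<le> 2 * sqrt (real l)"
      using that by simp
    finally show ?thesis .
  qed
  have second: "cmod (\<Sum>k<m. complex_of_real (c (l + k)) * z ^ (l + k)) \<le> 2 / d * c l" for m
    using norm_sum_antimono_le[of "\<lambda>k. c (l + k)" "\<lambda>k. z ^ (l + k)" "2 / d" m]
      c_anti c0 norm_sum_power_le[OF z, of l]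
    by (simp add: d_def scaleR_conv_of_real antimono_def)
  have sl: "2 * sqrt (real l) \<le> 2 / sqrt d"
    using real_sqrt_le_mono[OF l(1)] by (simp add: real_sqrt_divide)
  have "2 / d * c l \<le> 2 / sqrt d"
  proof -
    have "c l \<le> 1 / sqrt (real l + 1)"
      by (rule c1)
    also have "\<dots> \<le> 1 / sqrt (1 / d)"
      using l d by (intro divide_left_mono) simp_all
    also have "\<dots> = sqrt d"
      by (simp add: real_sqrt_divide)
    finally have "2 / d * c l \<le> 2 / d * sqrt d"
      using d by (intro mult_left_mono) simp_all
    also have "\<dots> = 2 / sqrt d"
      using d by (simp add: field_simps)
    finally show ?thesis .
  qed
  note second' = order_trans[OF second this]
  have "cmod (\<Sum>k<n. complex_of_real (c k) * z ^ k) \<le> 4 / sqrt d"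
  proof (cases "n \<le> l")
    case True
    have "0 \<le> 2 / sqrt d" "4 / sqrt d = 2 / sqrt d + 2 / sqrt d"
      using d by simp_all
    with first[OF True] sl show ?thesis
      by linarith
  next
    case False
    then obtain m where n: "n = l + m"
      by (metis le_add_diff_inverse nat_le_linear)
    have "(\<Sum>k<n. complex_of_real (c k) * z ^ k) = (\<Sum>k<l. complex_of_real (c k) * z ^ k)
        + (\<Sum>k<m. complex_of_real (c (l + k)) * z ^ (l + k))"
      unfolding n by (induction m) (simp_all add: algebra_simps)
    then have "cmod (\<Sum>k<n. complex_of_real (c k) * z ^ k) \<le> 2 / sqrt d + 2 / sqrt d"
      using norm_triangle_mono[OF order_trans[OF first[of l] sl] second'[of m]] by simp
    then show ?thesis
      by (simp add: field_simps)
  qed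
  then show ?thesis
    using d by (simp add: c_def d_def powr_half_sqrt)
qed

section \<open>Trigonometric polynomials on the torus\<close>

text \<open>Fubini's theorem for product functions. Since \<open>lborel\<close> is the image of a
  product measure indexed by \<open>Basis\<close>, the factors are first relabelled along the
  bijection of \<open>j\<close> with \<open>axis j 1\<close>.\<close>

lemma integral_lborel_prod:
  fixes f :: "'n::finite \<Rightarrow> real \<Rightarrow> complex"
  assumes f: "\<And>j. integrable lborel (f j)"
  shows "(\<integral>x. (\<Prod>j\<in>UNIV. f j (x $ j)) \<partial>(lborel :: (real ^ 'n) measure))
    = (\<Prod>j\<in>UNIV. \<integral>t. f j t \<partial>lborel)"
proof -
  interpret product_sigma_finite "\<lambda>_::real ^ 'n. lborel :: real measure" ..
  define g where "g b = f (THE j. b = axis j 1)" for b :: "real ^ 'n"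
  have g: "g (axis j 1) = f j" for j
    unfolding g_def by (simp add: axis_eq_axis)
  have inj: "inj (\<lambda>j::'n. axis j (1::real))"
    by (simp add: inj_on_def axis_eq_axis)
  have Basis: "Basis = range (\<lambda>j::'n. axis j (1::real))"
    by (auto simp: Basis_vec_def)
  have prod: "(\<Prod>b\<in>Basis. h b) = (\<Prod>j\<in>UNIV. h (axis j 1))" for h :: "real ^ 'n \<Rightarrow> complex"
    unfolding Basis by (simp add: prod.reindex[OF inj])
  have meas [measurable]: "f j \<in> borel_measurable borel" for j
    using borel_measurable_integrable[OF f] by simp
  have "(\<integral>x. (\<Prod>j\<in>UNIV. f j (x $ j)) \<partial>(lborel :: (real ^ 'n) measure))
      = (\<integral>x. (\<Prod>j\<in>UNIV. f j ((\<Sum>b\<in>Basis. x b *\<^sub>R b) $ j)) \<partial>(\<Pi>\<^sub>M b\<in>(Basis :: (real ^ 'n) set). lborel))"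
    by (subst lborel_eq) (subst integral_distr, auto)
  also have "\<dots> = (\<integral>x. (\<Prod>b\<in>Basis. g b (x b)) \<partial>(\<Pi>\<^sub>M b\<in>(Basis :: (real ^ 'n) set). lborel))"
  proof (rule Bochner_Integration.integral_cong[OF refl])
    fix x :: "real ^ 'n \<Rightarrow> real"
    have "(\<Sum>b\<in>Basis. x b *\<^sub>R b) $ j = x (axis j 1)" for j
    proof -
      have "(\<Sum>b\<in>Basis. x b *\<^sub>R b) $ j = (\<Sum>b\<in>Basis. x b *\<^sub>R b) \<bullet> axis j 1"
        by (simp add: inner_axis)
      also have "\<dots> = x (axis j 1)"
        by (rule inner_sum_left_Basis) (simp add: Basis)
      finally show ?thesis .
    qed
    then show "(\<Prod>j\<in>UNIV. f j ((\<Sum>b\<in>Basis. x b *\<^sub>R b) $ j)) = (\<Prod>b\<in>Basis. g b (x b))"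
      unfolding prod by (simp add: g)
  qed
  also have "\<dots> = (\<Prod>b\<in>Basis. \<integral>t. g b t \<partial>lborel)"
    by (rule product_integral_prod) (auto simp: Basis g f)
  finally show ?thesis
    unfolding prod by (simp add: g)
qed

lemma cis_sum: "finite A \<Longrightarrow> cis (\<Sum>j\<in>A. f j) = (\<Prod>j\<in>A. cis (f j))"
  by (induction A rule: finite_induct) (simp_all add: cis_mult[symmetric])

lemma character_eq_prod: "character \<alpha> \<theta> = (\<Prod>j\<in>UNIV. cis (\<theta> $ j) ^ \<alpha> j)"
  unfolding character_def by (simp add: cis_sum Complex.DeMoivre)

lemma norm_character [simp]: "cmod (character \<alpha> \<theta>) = 1"
  by (simp add: character_def)

text \<open>Frequencies are subtracted in \<open>int\<close> because subtraction on
  \<open>nat\<close> truncates. The product form allows integration one coordinate at a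
  time.\<close>

lemma character_mult_cnj:
  "character \<alpha> \<psi> * cnj (character \<beta> \<psi>) = (\<Prod>j\<in>UNIV. cis (of_int (int (\<alpha> j) - int (\<beta> j)) * \<psi> $ j))"
  by (simp add: character_def cis_cnj cis_mult sum_subtractf[symmetric] cis_sum[symmetric]
      algebra_simps)

lemma continuous_on_character [continuous_intros]: "continuous_on A (character \<alpha>)"
  unfolding character_def[abs_def] by (intro continuous_intros)

lemma torus_borel [measurable]: "torus \<in> sets borel"
  unfolding torus_def by measurable

text \<open>The half-open cube lies between an open and a closed box. Both facts together make
  \<open>torus_measure\<close> a probability measure.\<close>

lemma emeasure_torus: "emeasure lebesgue (torus :: (real ^ 'n) set) \<noteq> 0"
    "emeasure lebesgue (torus :: (real ^ 'n) set) \<noteq> \<infinity>"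
proof -
  let ?u = "(\<chi> j. 2 * pi) :: real ^ 'n"
  have "0 < emeasure lborel (box 0 ?u)"
    by (subst emeasure_lborel_box) (auto simp: Basis_vec_def inner_axis intro!: prod_pos)
  also have "\<dots> \<le> emeasure lborel (torus :: (real ^ 'n) set)"
    by (rule emeasure_mono) (auto simp: torus_def mem_box_cart less_imp_le)
  finally show "emeasure lebesgue (torus :: (real ^ 'n) set) \<noteq> 0"
    by simp
  have "emeasure lborel (torus :: (real ^ 'n) set) \<le> emeasure lborel (cbox 0 ?u)"
    by (rule emeasure_mono) (auto simp: torus_def mem_box_cart less_imp_le)
  also have "\<dots> < \<infinity>"
    by (rule emeasure_lborel_cbox_finite)
  finally show "emeasure lebesgue (torus :: (real ^ 'n) set) \<noteq> \<infinity>"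
    by simp
qed

lemma finite_measure_torus: "finite_measure (torus_measure :: (real ^ 'n) measure)"
  and measure_torus_measure: "measure (torus_measure :: (real ^ 'n) measure) UNIV = 1"
proof -
  have "emeasure (torus_measure :: (real ^ 'n) measure) UNIV = 1"
    unfolding torus_measure_def using emeasure_torus
    by (subst emeasure_uniform_measure) (auto simp: less_top intro!: ennreal_divide_self)
  then show "finite_measure (torus_measure :: (real ^ 'n) measure)"
      "measure (torus_measure :: (real ^ 'n) measure) UNIV = 1"
    by (auto intro!: finite_measureI simp: torus_measure_def measure_def)
qed

lemma borel_measurable_torus_measure:
  "f \<in> borel_measurable borel \<Longrightarrow> f \<in> borel_measurable torus_measure"
  unfolding torus_measure_def
  by (simp add: measurable_cong_sets[OF sets_uniform_measure refl] measurable_completion)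

text \<open>Passes from the normalized, completed measure to \<open>lborel\<close>, where the
  product formula is available.\<close>

lemma integral_torus_measure:
  fixes f :: "real ^ 'n \<Rightarrow> complex"
  assumes [measurable]: "f \<in> borel_measurable borel"
  shows "(\<integral>x. f x \<partial>torus_measure)
    = (\<integral>x. indicator torus x *\<^sub>R f x \<partial>lborel) /\<^sub>R measure lborel (torus :: (real ^ 'n) set)"
proof -
  let ?T = "torus :: (real ^ 'n) set"
  let ?c = "measure lborel ?T"
  have c: "emeasure lebesgue ?T = ennreal ?c" "?c > 0"
    using emeasure_torus[where 'n = 'n] emeasure_eq_ennreal_measure[of lborel ?T]
    by (auto simp: zero_less_measure_iff)
  have meas: "f \<in> borel_measurable lebesgue" "(\<lambda>x. indicator ?T x / ?c :: real) \<in> borel_measurable lebesgue"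
    by (rule measurable_completion, simp)+
  have "torus_measure = density lebesgue (\<lambda>x. ennreal (indicator ?T x / ?c))"
    unfolding torus_measure_def uniform_measure_def c(1)
    using c(2) divide_ennreal[of 1 ?c]
    by (intro arg_cong2[where f = density] refl ext) (auto split: split_indicator)
  then have "(\<integral>x. f x \<partial>torus_measure) = (\<integral>x. (indicator ?T x / ?c) *\<^sub>R f x \<partial>lebesgue)"
    using integral_density[OF meas] by simp
  also have "\<dots> = (\<integral>x. (indicator ?T x *\<^sub>R f x) /\<^sub>R ?c \<partial>lborel)"
    by (subst integral_completion) (auto simp: divide_inverse mult.commute)
  finally show ?thesis
    by (simp only: integral_scaleR_right)
qed

lemma integral_cis_period:
  fixes k :: int
  assumes "k \<noteq> 0"
  shows "(\<integral>t. indicator {0..<2 * pi} t *\<^sub>R cis (of_int k * t) \<partial>lborel) = 0"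
proof -
  \<comment> \<open>The fundamental theorem of calculus is applied on the closed interval, which
    differs from the half-open one by a null set.\<close>
  have "(\<integral>t. indicator {0..<2 * pi} t *\<^sub>R cis (of_int k * t) \<partial>lborel)
      = (\<integral>t. indicator {0..2 * pi} t *\<^sub>R cis (of_int k * t) \<partial>lborel)"
  proof (rule integral_cong_AE)
    show "AE t in lborel. indicator {0..<2 * pi} t *\<^sub>R cis (of_int k * t)
        = indicator {0..2 * pi} t *\<^sub>R cis (of_int k * t)"
      using AE_lborel_singleton[of "2 * pi"] by eventually_elim (auto simp: indicator_def)
    have [measurable]: "(\<lambda>t. cis (of_int k * t)) \<in> borel_measurable borel"
      by (intro borel_measurable_continuous_onI continuous_intros)
    show "(\<lambda>t. indicator {0..<2 * pi} t *\<^sub>R cis (of_int k * t)) \<in> borel_measurable lborel"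
        "(\<lambda>t. indicator {0..2 * pi} t *\<^sub>R cis (of_int k * t)) \<in> borel_measurable lborel"
      by measurable
  qed
  also have "\<dots> = cis (of_int k * (2 * pi)) / (\<i> * of_int k) - cis (of_int k * 0) / (\<i> * of_int k)"
  proof (rule integral_FTC_Icc)
    fix t :: real
    have "((\<lambda>t. exp (\<i> * of_int k * of_real t) / (\<i> * of_int k)) has_vector_derivative
        exp (\<i> * of_int k * of_real t)) (at t within {0..2 * pi})"
      using assms by (auto intro!: derivative_eq_intros has_vector_derivative_real_field)
    then show "((\<lambda>t. cis (of_int k * t) / (\<i> * of_int k)) has_vector_derivative
        cis (of_int k * t)) (at t within {0..2 * pi})"
      by (simp add: cis_conv_exp algebra_simps)
  qed (auto intro!: continuous_intros)
  also have "\<dots> = 0"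
    using cis_multiple_2pi[of "of_int k"] by (simp add: mult.commute)
  finally show ?thesis .
qed

lemma integrable_torus_measure:
  fixes f :: "real ^ 'n \<Rightarrow> 'b::{banach, second_countable_topology}"
  assumes "continuous_on UNIV f" "\<And>x. norm (f x) \<le> K"
  shows "integrable torus_measure f"
  using assms
  by (intro finite_measure.integrable_const_bound[OF finite_measure_torus, where B = K])
    (auto intro!: borel_measurable_torus_measure borel_measurable_continuous_onI)

lemma integral_character_mult_cnj:
  fixes \<alpha> \<beta> :: "'n::finite \<Rightarrow> nat"
  shows "(\<integral>\<psi>. character \<alpha> \<psi> * cnj (character \<beta> \<psi>) \<partial>torus_measure) = (if \<alpha> = \<beta> then 1 else 0)"
proof (cases "\<alpha> = \<beta>")
  case True
  have "character \<beta> \<psi> * cnj (character \<beta> \<psi>) = 1" for \<psi> :: "real ^ 'n"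
    by (simp flip: complex_norm_square)
  then show ?thesis
    using True measure_torus_measure[where 'n = 'n] by (simp add: torus_measure_def)
next
  case False
  then obtain i where i: "\<alpha> i \<noteq> \<beta> i"
    by auto
  \<comment> \<open>The indicator of \<open>torus\<close> is itself a product over the coordinates,
    so the whole integrand factors; the factor at \<open>i\<close> has a nonzero frequency and
    integrates to 0.\<close>
  define f where "f j t = indicator {0..<2 * pi} t *\<^sub>R cis (of_int (int (\<alpha> j) - int (\<beta> j)) * t)" for j t
  have int: "integrable lborel (f j)" for j
  proof -
    have "(\<lambda>t. cis (of_int (int (\<alpha> j) - int (\<beta> j)) * t)) \<in> borel_measurable borel"
      by (intro borel_measurable_continuous_onI continuous_intros)
    then show ?thesis
      unfolding f_def by (intro integrableI_bounded_set_indicator[where B = 1]) auto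
  qed
  have eq: "indicator torus x *\<^sub>R (character \<alpha> x * cnj (character \<beta> x)) = (\<Prod>j\<in>UNIV. f j (x $ j))" for x
  proof (cases "x \<in> torus")
    case True
    then show ?thesis
      by (simp add: character_mult_cnj f_def torus_def indicator_def)
  next
    case False
    then obtain j where "f j (x $ j) = 0"
      by (auto simp: f_def torus_def indicator_def)
    then show ?thesis
      using False by (auto intro!: prod_zero[symmetric])
  qed
  have "(\<integral>t. f i t \<partial>lborel) = 0"
    unfolding f_def using i by (intro integral_cis_period) simp
  then have "(\<Prod>j\<in>UNIV. \<integral>t. f j t \<partial>lborel) = 0"
    by (intro prod_zero) auto
  then have "(\<integral>x. indicator torus x *\<^sub>R (character \<alpha> x * cnj (character \<beta> x)) \<partial>lborel) = 0"
    unfolding eq by (simp add: integral_lborel_prod[OF int])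
  moreover have "(\<lambda>x. character \<alpha> x * cnj (character \<beta> x)) \<in> borel_measurable borel"
    by (intro borel_measurable_continuous_onI continuous_intros)
  ultimately show ?thesis
    using False by (simp add: integral_torus_measure)
qed

text \<open>Integrability and value are kept in one fact, so that finite linear combinations can be
  integrated by rule alone.\<close>

lemma character_orthonormal:
  "has_bochner_integral torus_measure (\<lambda>\<psi>. character \<alpha> \<psi> * cnj (character \<beta> \<psi>))
    (if \<alpha> = \<beta> then 1 else 0)"
proof -
  have "integrable torus_measure (\<lambda>\<psi>. character \<alpha> \<psi> * cnj (character \<beta> \<psi>))"
    by (rule integrable_torus_measure[where K = 1]) (auto intro!: continuous_intros simp: norm_mult)
  then show ?thesis
    by (simp add: has_bochner_integral_iff integral_character_mult_cnj)
qed

section \<open>Weighted polynomials and Parseval's identity\<close>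

definition weight :: "('n::finite \<Rightarrow> nat) \<Rightarrow> real"
  where "weight \<alpha> = (\<Prod>j\<in>UNIV. real (\<alpha> j) + 1)"

lemma weight_pos: "weight \<alpha> > 0"
  unfolding weight_def by (intro prod_pos) simp

text \<open>The square root of the weight makes the squared \<open>L\<^sup>2\<close> norm equal to
  the Dirichlet energy of the coefficients in \<open>F\<close>.\<close>

definition weighted_poly ::
  "(('n::finite \<Rightarrow> nat) \<Rightarrow> 'h::complex_hilbert_space) \<Rightarrow> ('n \<Rightarrow> nat) set \<Rightarrow> real ^ 'n \<Rightarrow> 'h"
  where "weighted_poly a F \<psi> =
    (\<Sum>\<alpha>\<in>F. (complex_of_real (sqrt (weight \<alpha>)) * character \<alpha> \<psi>) *\<^sub>C a \<alpha>)"

lemma continuous_on_norm_weighted_poly: "continuous_on UNIV (\<lambda>\<psi>. norm (weighted_poly a F \<psi>))"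
  unfolding weighted_poly_def
  by (intro continuous_intros bounded_linear.continuous_on[OF bounded_linear_scaleC_left])

text \<open>Parseval's identity. The squared norm expands into a double sum of scalar products of
  characters, of which orthonormality keeps the diagonal.\<close>

lemma nn_integral_norm_weighted_poly:
  assumes F: "finite F"
  shows "(\<integral>\<^sup>+ \<psi>. (ennreal (norm (weighted_poly a F \<psi>)))\<^sup>2 \<partial>torus_measure)
    = ennreal (\<Sum>\<alpha>\<in>F. weight \<alpha> * (norm (a \<alpha>))\<^sup>2)"
proof -
  define f where "f \<psi> = (norm (weighted_poly a F \<psi>))\<^sup>2" for \<psi>
  define c where "c \<alpha> \<beta> = complex_of_real (sqrt (weight \<alpha>) * sqrt (weight \<beta>)) * cinner (a \<alpha>) (a \<beta>)" for \<alpha> \<beta>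
  have f: "complex_of_real (f \<psi>) = (\<Sum>\<alpha>\<in>F. \<Sum>\<beta>\<in>F. c \<alpha> \<beta> * (character \<alpha> \<psi> * cnj (character \<beta> \<psi>)))" for \<psi>
    unfolding f_def c_def cinner_self[symmetric] weighted_poly_def cinner_sum_left
    unfolding cinner_sum_right
    by (simp add: cinner_scaleC_left cinner_scaleC_right mult_ac)
  have "(\<Sum>\<alpha>\<in>F. \<Sum>\<beta>\<in>F. c \<alpha> \<beta> * (if \<alpha> = \<beta> then 1 else 0)) = (\<Sum>\<alpha>\<in>F. c \<alpha> \<alpha>)"
    using F by (simp add: if_distrib cong: if_cong)
  also have "\<dots> = complex_of_real (\<Sum>\<alpha>\<in>F. weight \<alpha> * (norm (a \<alpha>))\<^sup>2)"
    unfolding of_real_sum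
    by (intro sum.cong refl) (simp add: c_def cinner_self weight_pos less_imp_le abs_of_pos)
  finally have eq: "(\<Sum>\<alpha>\<in>F. \<Sum>\<beta>\<in>F. c \<alpha> \<beta> * (if \<alpha> = \<beta> then 1 else 0))
      = complex_of_real (\<Sum>\<alpha>\<in>F. weight \<alpha> * (norm (a \<alpha>))\<^sup>2)" .
  have int: "has_bochner_integral torus_measure (\<lambda>\<psi>. complex_of_real (f \<psi>))
      (complex_of_real (\<Sum>\<alpha>\<in>F. weight \<alpha> * (norm (a \<alpha>))\<^sup>2))"
    unfolding f eq[symmetric]
    by (intro has_bochner_integral_sum has_bochner_integral_mult_right character_orthonormal)
  then have val: "(\<integral>\<psi>. f \<psi> \<partial>torus_measure) = (\<Sum>\<alpha>\<in>F. weight \<alpha> * (norm (a \<alpha>))\<^sup>2)"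
    unfolding has_bochner_integral_iff integral_complex_of_real of_real_eq_iff ..
  have "(\<integral>\<^sup>+ \<psi>. ennreal (f \<psi>) \<partial>torus_measure) = ennreal (\<integral>\<psi>. f \<psi> \<partial>torus_measure)"
    using integrable_Re[OF integrable.intros[OF int]]
    by (intro nn_integral_eq_integral) (auto simp: f_def)
  then show ?thesis
    unfolding val by (simp add: f_def ennreal_power)
qed

section \<open>Product kernels and domination by potentials\<close>

lemma potential_kernel_measurable:
  "(\<lambda>\<psi>. \<Prod>j\<in>UNIV. 1 / ennreal (cmod (cis (\<theta> $ j) - cis (\<psi> $ j)) powr (1 / 2)))
    \<in> borel_measurable torus_measure"
proof (rule borel_measurable_torus_measure)
  have [measurable]: "cis \<in> borel_measurable borel"
    by (intro borel_measurable_continuous_onI continuous_intros)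
  show "(\<lambda>\<psi>. \<Prod>j\<in>UNIV. 1 / ennreal (cmod (cis (\<theta> $ j) - cis (\<psi> $ j)) powr (1 / 2)))
    \<in> borel_measurable borel"
    by measurable
qed

lemma kernel_bound_ennreal:
  fixes \<rho> :: "nat \<Rightarrow> real"
  assumes \<rho>: "antimono \<rho>" "\<And>k. 0 \<le> \<rho> k" "\<And>k. \<rho> k \<le> 1"
  shows "ennreal (cmod (\<Sum>k<n. complex_of_real (\<rho> k / sqrt (real k + 1)) * (cis s * cnj (cis t)) ^ k))
    \<le> 4 * (1 / ennreal (cmod (cis s - cis t) powr (1 / 2)))"
proof (cases "cis s = cis t")
  \<comment> \<open>On the singular set the right-hand side is infinite, because
    \<open>1 / 0 = \<infinity>\<close> in \<open>ennreal\<close>.\<close>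
  case True
  then show ?thesis
    by (simp add: ennreal_mult_top)
next
  case False
  \<comment> \<open>A rotation by \<open>cis t\<close> moves the singularity to 1, where
    \<open>kernel_bound\<close> applies.\<close>
  have "cis s * cnj (cis t) - 1 = (cis s - cis t) * cnj (cis t)"
    by (simp add: algebra_simps flip: complex_norm_square)
  then have eq: "cmod (cis s * cnj (cis t) - 1) = cmod (cis s - cis t)"
    by (simp add: norm_mult)
  then have ne: "cis s * cnj (cis t) \<noteq> 1"
    using False by auto
  have pos: "cmod (cis s - cis t) powr (1 / 2) > 0"
    using False by simp
  have "cmod (\<Sum>k<n. complex_of_real (\<rho> k / sqrt (real k + 1)) * (cis s * cnj (cis t)) ^ k)
      \<le> 4 / cmod (cis s - cis t) powr (1 / 2)"
    using kernel_bound[OF \<rho>, of "cis s * cnj (cis t)" n] eq ne by (simp add: norm_mult)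
  then have "ennreal (cmod (\<Sum>k<n. complex_of_real (\<rho> k / sqrt (real k + 1)) * (cis s * cnj (cis t)) ^ k))
      \<le> ennreal (4 * (1 / cmod (cis s - cis t) powr (1 / 2)))"
    by (simp add: ennreal_leI)
  also have "\<dots> = 4 * (1 / ennreal (cmod (cis s - cis t) powr (1 / 2)))"
    using divide_ennreal[OF _ pos, of 1] by (subst ennreal_mult') simp_all
  finally show ?thesis .
qed

text \<open>Distributivity: choosing one exponent per coordinate is choosing a multi-index. The
  factor \<open>1 / sqrt (weight \<gamma>)\<close> is there to cancel the weight in
  \<open>weighted_poly\<close>.\<close>

lemma kernel_product:
  fixes \<theta> \<psi> :: "real ^ 'n::finite" and \<rho> :: "'n \<Rightarrow> nat \<Rightarrow> real"
  shows "(\<Prod>j\<in>UNIV. \<Sum>k<n. complex_of_real (\<rho> j k / sqrt (real k + 1)) * (cis (\<theta> $ j) * cnj (cis (\<psi> $ j))) ^ k)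
    = (\<Sum>\<gamma> | \<forall>j. \<gamma> j < n. complex_of_real ((\<Prod>j\<in>UNIV. \<rho> j (\<gamma> j)) / sqrt (weight \<gamma>))
        * character \<gamma> \<theta> * cnj (character \<gamma> \<psi>))"
proof -
  have sqrt: "sqrt (\<Prod>j\<in>A. f j) = (\<Prod>j\<in>A. sqrt (f j))" for f :: "'n \<Rightarrow> real" and A
    by (induction A rule: infinite_finite_induct) (simp_all add: real_sqrt_mult)
  have set: "(UNIV :: 'n set) \<rightarrow>\<^sub>E {..<n} = {\<gamma>. \<forall>j. \<gamma> j < n}"
    by (auto simp: PiE_def)
  show ?thesis
    by (subst prod_sum_PiE)
      (simp_all add: set character_eq_prod weight_def sqrt prod.distrib prod_dividef
        power_mult_distrib mult.assoc)
qed

text \<open>Pairing with the vector to be estimated keeps all integrals scalar. The orthogonality of the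
  characters turns the multiplier sum into an integral of the weighted polynomial against a
  product of one-dimensional kernels.\<close>

lemma norm_multiplier_sum_le_potential:
  fixes a :: "('n::finite \<Rightarrow> nat) \<Rightarrow> 'h::complex_hilbert_space"
  assumes F: "finite F"
    and \<rho>: "\<And>j. antimono (\<rho> j)" "\<And>j k. 0 \<le> \<rho> j k" "\<And>j k. \<rho> j k \<le> (1::real)"
  shows "ennreal (norm (\<Sum>\<alpha>\<in>F. (complex_of_real (\<Prod>j\<in>UNIV. \<rho> j (\<alpha> j)) * character \<alpha> \<theta>) *\<^sub>C a \<alpha>))
    \<le> 4 ^ CARD('n) * potential (\<lambda>\<psi>. ennreal (norm (weighted_poly a F \<psi>))) \<theta>"
proof -
  define s where "s = (\<Sum>\<alpha>\<in>F. (complex_of_real (\<Prod>j\<in>UNIV. \<rho> j (\<alpha> j)) * character \<alpha> \<theta>) *\<^sub>C a \<alpha>)"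
  have "finite ((\<lambda>(\<alpha>, j). \<alpha> j) ` (F \<times> UNIV))"
    using F by simp
  \<comment> \<open>A common bound for all exponents in \<open>F\<close>, so that the truncated
    kernels retain every frequency of the polynomial.\<close>
  then obtain n where "\<forall>m\<in>(\<lambda>(\<alpha>, j). \<alpha> j) ` (F \<times> UNIV). m < n"
    unfolding finite_nat_set_iff_bounded by blast
  then have n: "\<alpha> j < n" if "\<alpha> \<in> F" for \<alpha> j
    using that by force
  define B where "B = {\<gamma> :: 'n \<Rightarrow> nat. \<forall>j. \<gamma> j < n}"
  have "B = (UNIV :: 'n set) \<rightarrow>\<^sub>E {..<n}"
    by (auto simp: B_def PiE_def)
  then have B: "finite B" "F \<subseteq> B"
    using n by (auto simp: B_def intro!: finite_PiE)
  define K where "K \<psi> = (\<Prod>j\<in>UNIV. \<Sum>k<n. complex_of_real (\<rho> j k / sqrt (real k + 1))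
    * (cis (\<theta> $ j) * cnj (cis (\<psi> $ j))) ^ k)" for \<psi> :: "real ^ 'n"
  define L where "L \<psi> = (\<Prod>j\<in>UNIV. 1 / ennreal (cmod (cis (\<theta> $ j) - cis (\<psi> $ j)) powr (1 / 2)))"
    for \<psi> :: "real ^ 'n"
  define c where "c \<alpha> \<gamma> = complex_of_real (sqrt (weight \<alpha>)) * cinner (a \<alpha>) s
    * (complex_of_real ((\<Prod>j\<in>UNIV. \<rho> j (\<gamma> j)) / sqrt (weight \<gamma>)) * character \<gamma> \<theta>)" for \<alpha> \<gamma>
  have expand: "cinner (weighted_poly a F \<psi>) s * K \<psi>
      = (\<Sum>\<alpha>\<in>F. \<Sum>\<gamma>\<in>B. c \<alpha> \<gamma> * (character \<alpha> \<psi> * cnj (character \<gamma> \<psi>)))" for \<psi>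
    unfolding K_def kernel_product B_def[symmetric] weighted_poly_def cinner_sum_left sum_product
    by (simp add: cinner_scaleC_left c_def mult_ac)
  \<comment> \<open>Because \<open>F \<subseteq> B\<close>, every \<open>\<alpha>\<close> meets its
    diagonal term. There the square roots of the weight cancel and the pairing of the multiplier sum
    \<open>s\<close> with itself remains.\<close>
  have "(\<Sum>\<alpha>\<in>F. \<Sum>\<gamma>\<in>B. c \<alpha> \<gamma> * (if \<alpha> = \<gamma> then 1 else 0)) = (\<Sum>\<alpha>\<in>F. c \<alpha> \<alpha>)"
    using B by (intro sum.cong refl) (auto simp: if_distrib cong: if_cong)
  also have "\<dots> = cinner s s"
  proof -
    have "c \<alpha> \<alpha> = complex_of_real (\<Prod>j\<in>UNIV. \<rho> j (\<alpha> j)) * character \<alpha> \<theta> * cinner (a \<alpha>) s" for \<alpha>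
      using weight_pos[of \<alpha>] by (simp add: c_def)
    then show ?thesis
      by (subst (1) s_def) (simp add: cinner_sum_left cinner_scaleC_left)
  qed
  finally have eq: "(\<Sum>\<alpha>\<in>F. \<Sum>\<gamma>\<in>B. c \<alpha> \<gamma> * (if \<alpha> = \<gamma> then 1 else 0)) = cinner s s" .
  have int: "has_bochner_integral torus_measure (\<lambda>\<psi>. cinner (weighted_poly a F \<psi>) s * K \<psi>) (cinner s s)"
    unfolding expand eq[symmetric]
    by (intro has_bochner_integral_sum has_bochner_integral_mult_right character_orthonormal)
  have K: "ennreal (cmod (K \<psi>)) \<le> 4 ^ CARD('n) * L \<psi>" for \<psi>
  proof -
    have "ennreal (cmod (K \<psi>)) \<le> (\<Prod>j\<in>UNIV. 4 * (1 / ennreal (cmod (cis (\<theta> $ j) - cis (\<psi> $ j)) powr (1 / 2))))"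
      unfolding K_def prod_norm[symmetric] prod_ennreal[OF norm_ge_zero, symmetric]
      by (intro prod_mono_ennreal kernel_bound_ennreal \<rho>)
    also have "\<dots> = 4 ^ CARD('n) * L \<psi>"
      unfolding prod.distrib L_def by simp
    finally show ?thesis .
  qed
  have pw: "ennreal (cmod (cinner (weighted_poly a F \<psi>) s * K \<psi>))
      \<le> (ennreal (norm s) * 4 ^ CARD('n)) * (L \<psi> * ennreal (norm (weighted_poly a F \<psi>)))" for \<psi>
  proof -
    have "ennreal (cmod (cinner (weighted_poly a F \<psi>) s * K \<psi>))
        \<le> ennreal (norm (weighted_poly a F \<psi>) * norm s * cmod (K \<psi>))"
      unfolding norm_mult by (intro ennreal_leI mult_right_mono norm_cinner_le) simp
    also have "\<dots> = ennreal (norm (weighted_poly a F \<psi>)) * ennreal (norm s) * ennreal (cmod (K \<psi>))"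
      by (simp add: ennreal_mult)
    also have "\<dots> \<le> ennreal (norm (weighted_poly a F \<psi>)) * ennreal (norm s) * (4 ^ CARD('n) * L \<psi>)"
      by (intro mult_left_mono K) simp
    finally show ?thesis
      by (simp add: mult_ac)
  qed
  have meas: "(\<lambda>\<psi>. L \<psi> * ennreal (norm (weighted_poly a F \<psi>))) \<in> borel_measurable torus_measure"
    unfolding L_def
    by (intro borel_measurable_times_ennreal potential_kernel_measurable measurable_compose[OF _ measurable_ennreal]
        borel_measurable_torus_measure borel_measurable_continuous_onI continuous_on_norm_weighted_poly)
  have "ennreal (norm s) * ennreal (norm s) = ennreal (cmod (cinner s s))"
    unfolding cinner_self norm_of_real by (simp add: power2_eq_square ennreal_mult)
  also have "\<dots> \<le> (\<integral>\<^sup>+ \<psi>. ennreal (cmod (cinner (weighted_poly a F \<psi>) s * K \<psi>)) \<partial>torus_measure)"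
    by (rule has_bochner_integral_norm_bound[OF int])
  also have "\<dots> \<le> (\<integral>\<^sup>+ \<psi>. (ennreal (norm s) * 4 ^ CARD('n)) * (L \<psi> * ennreal (norm (weighted_poly a F \<psi>))) \<partial>torus_measure)"
    by (intro nn_integral_mono pw)
  also have "\<dots> = (ennreal (norm s) * 4 ^ CARD('n)) * potential (\<lambda>\<psi>. ennreal (norm (weighted_poly a F \<psi>))) \<theta>"
    unfolding nn_integral_cmult[OF meas] by (simp add: potential_def L_def)
  finally have *: "ennreal (norm s) * ennreal (norm s)
      \<le> ennreal (norm s) * (4 ^ CARD('n) * potential (\<lambda>\<psi>. ennreal (norm (weighted_poly a F \<psi>))) \<theta>)"
    by (simp add: mult.assoc)
  \<comment> \<open>The pairing produced one surplus factor \<open>norm s\<close> on each side. It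
    is finite, and can be cancelled as soon as it is nonzero.\<close>
  show ?thesis
    unfolding s_def[symmetric]
  proof (cases "s = 0")
    case False
    then show "ennreal (norm s) \<le> 4 ^ CARD('n) * potential (\<lambda>\<psi>. ennreal (norm (weighted_poly a F \<psi>))) \<theta>"
      using * by (subst (asm) ennreal_mult_le_mult_iff) simp_all
  qed simp
qed

section \<open>Exceptional sets\<close>

text \<open>Every positive multiple of \<open>g\<close> still has infinite potential on this set,
  hence is admissible for the capacity, while its energy can be made arbitrarily small.\<close>

lemma capacity_potential_infinite:
  fixes g :: "real ^ 'n::finite \<Rightarrow> ennreal"
  assumes g: "g \<in> borel_measurable torus_measure"
    and fin: "(\<integral>\<^sup>+ \<psi>. (g \<psi>)\<^sup>2 \<partial>torus_measure) < \<infinity>"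
  shows "capacity {\<theta>\<in>torus. potential g \<theta> = \<infinity>} = 0"
proof -
  obtain i where i: "0 \<le> i" "(\<integral>\<^sup>+ \<psi>. (g \<psi>)\<^sup>2 \<partial>torus_measure) = ennreal i"
    using fin by (auto simp: less_top_ennreal)
  have "capacity {\<theta>\<in>torus. potential g \<theta> = \<infinity>} \<le> 0 + ennreal e" if e: "0 < e" for e
  proof -
    \<comment> \<open>Chosen so that the energy \<open>c\<^sup>2 * i\<close> is at most
      \<open>e\<close>; the summand 1 keeps the denominator positive when
      \<open>i = 0\<close>.\<close>
    define c where "c = sqrt (e / (i + 1))"
    have c: "c > 0" "c\<^sup>2 * i \<le> e"
      using e i(1) by (simp_all add: c_def field_simps)
    have pot: "potential (\<lambda>\<psi>. ennreal c * g \<psi>) \<theta> = ennreal c * potential g \<theta>" for \<theta>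
      unfolding potential_def
      by (subst nn_integral_cmult[symmetric])
        (auto intro!: borel_measurable_times_ennreal potential_kernel_measurable g simp: mult_ac)
    have "capacity {\<theta>\<in>torus. potential g \<theta> = \<infinity>} \<le> (\<integral>\<^sup>+ \<psi>. (ennreal c * g \<psi>)\<^sup>2 \<partial>torus_measure)"
      unfolding capacity_def using g c(1) by (intro INF_lower) (auto simp: pot ennreal_mult_top)
    also have "\<dots> = (\<integral>\<^sup>+ \<psi>. ennreal (c\<^sup>2) * (g \<psi>)\<^sup>2 \<partial>torus_measure)"
      using c(1) by (simp add: power_mult_distrib ennreal_power)
    also have "\<dots> = ennreal (c\<^sup>2) * ennreal i"
      using g by (simp add: nn_integral_cmult i(2))
    also have "\<dots> \<le> ennreal e"
      using c(2) i(1) by (simp add: ennreal_mult[symmetric] ennreal_leI)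
    finally show ?thesis
      by simp
  qed
  then have "capacity {\<theta>\<in>torus. potential g \<theta> = \<infinity>} \<le> 0"
    by (rule ennreal_le_epsilon)
  then show ?thesis
    by simp
qed

section \<open>Series summed in finite blocks\<close>

text \<open>Summability gives, for each \<open>m\<close>, a finite set such that every finite set
  disjoint from it has sum at most \<open>\<epsilon> m\<close>. Block \<open>Suc m\<close> is made
  to avoid that set; block 0 carries no smallness condition.\<close>

lemma finite_blocks_with_small_tails:
  fixes f :: "'a::countable \<Rightarrow> real"
  assumes f: "f summable_on UNIV" and \<epsilon>: "\<And>m. \<epsilon> m > 0"
  obtains D :: "nat \<Rightarrow> 'a set" where "\<And>m. finite (D m)" "disjoint_family D" "(\<Union>m. D m) = UNIV"
    "\<And>m. sum f (D (Suc m)) \<le> \<epsilon> m"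
proof -
  obtain S where S: "(f has_sum S) UNIV"
    using f by (auto simp: summable_on_def)
  have "\<exists>A. finite A \<and> (\<forall>B. finite B \<and> A \<inter> B = {} \<longrightarrow> sum f B \<le> \<epsilon> m)" for m
  proof -
    have "\<forall>\<^sub>F A in finite_subsets_at_top UNIV. dist (sum f A) S < \<epsilon> m / 2"
      using S \<epsilon>[of m] unfolding has_sum_def by (intro tendstoD) auto
    then obtain A where A: "finite A" "\<And>B. finite B \<Longrightarrow> A \<subseteq> B \<Longrightarrow> dist (sum f B) S < \<epsilon> m / 2"
      by (auto simp: eventually_finite_subsets_at_top)
    have "sum f B \<le> \<epsilon> m" if B: "finite B" "A \<inter> B = {}" for B
    proof -
      \<comment> \<open>Both \<open>A\<close> and \<open>A \<union> B\<close> have sums within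
        \<open>\<epsilon> m / 2\<close> of the total, so the sum over \<open>B\<close> is less than
        \<open>\<epsilon> m\<close>.\<close>
      have "dist (sum f A) S < \<epsilon> m / 2" "dist (sum f A + sum f B) S < \<epsilon> m / 2"
        using A(2)[of A] A(2)[of "A \<union> B"] A(1) B by (simp_all add: sum.union_disjoint)
      then show ?thesis
        unfolding dist_real_def by linarith
    qed
    with A(1) show ?thesis
      by blast
  qed
  then obtain A where A: "\<And>m. finite (A m)" "\<And>m B. finite B \<Longrightarrow> A m \<inter> B = {} \<Longrightarrow> sum f B \<le> \<epsilon> m"
    by metis
  \<comment> \<open>The initial segments of an enumeration make the sets exhaust the type. Since
    \<open>A m \<subseteq> E m\<close>, the next disjointed set misses \<open>A m\<close>.\<close>
  define E where "E m = A m \<union> to_nat -` {..m}" for m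
  have fin: "finite (E m)" for m
    unfolding E_def by (intro finite_UnI A(1) finite_vimageI inj_to_nat) simp
  have finD: "finite (disjointed E m)" for m
    using fin disjointed_subset by (rule finite_subset[rotated])
  show ?thesis
  proof (rule that[of "disjointed E"])
    show "(\<Union>m. disjointed E m) = UNIV"
      unfolding UN_disjointed_eq by (auto simp: E_def)
    show "sum f (disjointed E (Suc m)) \<le> \<epsilon> m" for m
      by (intro A(2) finD) (auto simp: disjointed_def E_def)
  qed (simp_all add: finD disjoint_family_disjointed)
qed

text \<open>The unions of the first blocks eventually contain any given finite set, so they run
  through the net that defines the unordered sum.\<close>

lemma infsum_sums_blocks:
  fixes f :: "'a \<Rightarrow> 'b::banach"
  assumes f: "f summable_on UNIV"
    and D: "\<And>m. finite (D m)" "disjoint_family D" "(\<Union>m. D m) = UNIV"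
  shows "(\<lambda>m. sum f (D m)) sums infsum f UNIV"
proof -
  have "filterlim (\<lambda>m. \<Union>k<m. D k) (finite_subsets_at_top UNIV) sequentially"
    unfolding filterlim_finite_subsets_at_top
  proof (intro allI impI)
    fix X :: "'a set"
    assume X: "finite X \<and> X \<subseteq> UNIV"
    have "\<forall>x. \<exists>k. x \<in> D k"
      using D(3) by blast
    then obtain k where k: "\<And>x. x \<in> D (k x)"
      by metis
    obtain n where n: "\<And>x. x \<in> X \<Longrightarrow> k x < n"
      using X finite_nat_set_iff_bounded[of "k ` X"] by auto
    show "\<forall>\<^sub>F m in sequentially. finite (\<Union>k<m. D k) \<and> X \<subseteq> (\<Union>k<m. D k) \<and> (\<Union>k<m. D k) \<subseteq> UNIV"
      using eventually_ge_at_top[of n]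
    proof eventually_elim
      case (elim m)
      have "x \<in> (\<Union>k<m. D k)" if "x \<in> X" for x
        using k[of x] n[OF that] elim by (auto intro!: bexI[of _ "k x"])
      then show ?case
        using D(1) by blast
    qed
  qed
  then have "(\<lambda>m. sum f (\<Union>k<m. D k)) \<longlonglongrightarrow> infsum f UNIV"
    using has_sum_infsum[OF f] unfolding has_sum_def by (rule filterlim_compose[rotated])
  moreover have "sum f (\<Union>k<m. D k) = (\<Sum>k<m. sum f (D k))" for m
    using D by (intro sum.UNION_disjoint) (auto simp: disjoint_family_on_def)
  ultimately show ?thesis
    by (simp add: sums_def)
qed

text \<open>Cauchy-Schwarz for the splitting of \<open>g m\<close> into \<open>(1 / 2) ^ m\<close>
  and \<open>2 ^ m * g m\<close>. The price \<open>4 ^ m\<close> is later paid by the decay of the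
  block energies.\<close>

lemma square_suminf_le:
  fixes g :: "nat \<Rightarrow> ennreal"
  shows "(\<Sum>m. g m)\<^sup>2 \<le> (\<Sum>m. ennreal ((1 / 4) ^ m)) * (\<Sum>m. 4 ^ m * (g m)\<^sup>2)"
proof -
  have prod: "ennreal ((1 / 2) ^ m) * (2 ^ m * g m) = g m" for m
  proof -
    have "ennreal ((1 / 2) ^ m) * 2 ^ m = ennreal ((1 / 2) ^ m * 2 ^ m)"
      by (simp add: ennreal_mult ennreal_power[symmetric])
    then show ?thesis
      by (simp add: mult.assoc[symmetric] power_one_over)
  qed
  have left: "(ennreal ((1 / 2) ^ m))\<^sup>2 = ennreal ((1 / 4) ^ m)" for m
  proof -
    have "((1 / 2 :: real) ^ m)\<^sup>2 = (1 / 4) ^ m"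
      by (simp add: power2_eq_square flip: power_mult_distrib)
    then show ?thesis
      by (simp add: ennreal_power)
  qed
  have right: "(2 ^ m * g m)\<^sup>2 = 4 ^ m * (g m)\<^sup>2" for m
  proof -
    have "(2 ^ m :: ennreal)\<^sup>2 = 4 ^ m"
      by (simp add: power2_eq_square flip: power_mult_distrib)
    then show ?thesis
      by (simp add: power_mult_distrib)
  qed
  have "(\<integral>\<^sup>+ m. ennreal ((1 / 2) ^ m) * (2 ^ m * g m) \<partial>count_space UNIV)\<^sup>2
      \<le> (\<integral>\<^sup>+ m. (ennreal ((1 / 2) ^ m))\<^sup>2 \<partial>count_space UNIV) * (\<integral>\<^sup>+ m. (2 ^ m * g m)\<^sup>2 \<partial>count_space UNIV)"
    by (rule Cauchy_Schwarz_nn_integral) simp_all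
  then show ?thesis
    unfolding nn_integral_count_space_nat prod left right .
qed

section \<open>Convergence of multiplier sums\<close>

text \<open>The common class of \<open>r ^ k\<close> and of indicators of initial segments, through
  which dilations and rectangular sums are treated alike.\<close>

definition multiplier :: "('n \<Rightarrow> nat \<Rightarrow> real) \<Rightarrow> bool"
  where "multiplier \<rho> \<longleftrightarrow> (\<forall>j. antimono (\<rho> j) \<and> (\<forall>k. 0 \<le> \<rho> j k \<and> \<rho> j k \<le> 1))"

definition multiplier_term ::
  "(('n::finite \<Rightarrow> nat) \<Rightarrow> 'h::complex_hilbert_space) \<Rightarrow> ('n \<Rightarrow> nat \<Rightarrow> real) \<Rightarrow> real ^ 'n
    \<Rightarrow> ('n \<Rightarrow> nat) \<Rightarrow> 'h"
  where "multiplier_term a \<rho> \<theta> \<alpha> =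
    (complex_of_real (\<Prod>j\<in>UNIV. \<rho> j (\<alpha> j)) * character \<alpha> \<theta>) *\<^sub>C a \<alpha>"

text \<open>Dominated convergence over the blocks: each block is a finite sum and converges
  termwise, and \<open>c\<close> dominates uniformly in the multiplier. The filter is arbitrary and
  the limit does not depend on it, so different summation methods get the same value.\<close>

lemma multiplier_infsum_bound_tendsto:
  fixes a :: "('n::finite \<Rightarrow> nat) \<Rightarrow> 'h::complex_hilbert_space"
  assumes D: "\<And>m. finite (D m)" "disjoint_family D" "(\<Union>m. D m) = UNIV"
    and c: "summable c" "\<And>m \<rho>. multiplier \<rho> \<Longrightarrow> norm (sum (multiplier_term a \<rho> \<theta>) (D m)) \<le> c m"
  shows "\<And>\<rho>. multiplier \<rho> \<Longrightarrow> multiplier_term a \<rho> \<theta> summable_on UNIV \<Longrightarrow>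
      norm (infsum (multiplier_term a \<rho> \<theta>) UNIV) \<le> suminf c"
    and "\<And>F (\<rho> :: 'i \<Rightarrow> 'n \<Rightarrow> nat \<Rightarrow> real).
      \<forall>\<^sub>F i in F. multiplier (\<rho> i) \<and> multiplier_term a (\<rho> i) \<theta> summable_on UNIV \<Longrightarrow>
      (\<And>j k. ((\<lambda>i. \<rho> i j k) \<longlongrightarrow> 1) F) \<Longrightarrow>
      ((\<lambda>i. infsum (multiplier_term a (\<rho> i) \<theta>) UNIV) \<longlongrightarrow>
        (\<Sum>m. \<Sum>\<alpha>\<in>D m. character \<alpha> \<theta> *\<^sub>C a \<alpha>)) F"
proof -
  have sums: "(\<lambda>m. sum (multiplier_term a \<rho> \<theta>) (D m)) sums infsum (multiplier_term a \<rho> \<theta>) UNIV"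
    if "multiplier_term a \<rho> \<theta> summable_on UNIV" for \<rho>
    using that D by (rule infsum_sums_blocks)
  show "norm (infsum (multiplier_term a \<rho> \<theta>) UNIV) \<le> suminf c"
    if "multiplier \<rho>" "multiplier_term a \<rho> \<theta> summable_on UNIV" for \<rho>
    unfolding sums_unique[OF sums[OF that(2)]] using c(2)[OF that(1)] c(1) by (rule norm_suminf_le)
  fix F and \<rho> :: "'i \<Rightarrow> 'n \<Rightarrow> nat \<Rightarrow> real"
  assume ev: "\<forall>\<^sub>F i in F. multiplier (\<rho> i) \<and> multiplier_term a (\<rho> i) \<theta> summable_on UNIV"
    and lim: "\<And>j k. ((\<lambda>i. \<rho> i j k) \<longlongrightarrow> 1) F"
  let ?S = "{i. multiplier (\<rho> i) \<and> multiplier_term a (\<rho> i) \<theta> summable_on UNIV}"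
  let ?f = "\<lambda>m i. sum (multiplier_term a (\<rho> i) \<theta>) (D m)"
  let ?g = "\<lambda>m. \<Sum>\<alpha>\<in>D m. character \<alpha> \<theta> *\<^sub>C a \<alpha>"
  have flim: "(?f m \<longlongrightarrow> ?g m) F" for m
  proof (intro tendsto_sum)
    fix \<alpha>
    have "((\<lambda>i. complex_of_real (\<Prod>j\<in>UNIV. \<rho> i j (\<alpha> j)) * character \<alpha> \<theta>) \<longlongrightarrow>
        complex_of_real (\<Prod>j\<in>(UNIV :: 'n set). 1) * character \<alpha> \<theta>) F"
      by (intro tendsto_intros lim)
    from bounded_linear.tendsto[OF bounded_linear_scaleC_left this]
    show "((\<lambda>i. multiplier_term a (\<rho> i) \<theta> \<alpha>) \<longlongrightarrow> character \<alpha> \<theta> *\<^sub>C a \<alpha>) F"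
      by (simp add: multiplier_term_def)
  qed
  show "((\<lambda>i. infsum (multiplier_term a (\<rho> i) \<theta>) UNIV) \<longlongrightarrow> suminf ?g) F"
  proof (cases "F = bot")
    case False
    \<comment> \<open>The domination passes to the limit only along a nontrivial filter, hence the
      case distinction; along \<open>bot\<close> every limit holds.\<close>
    have g: "norm (?g m) \<le> c m" for m
    proof (rule tendsto_upperbound[OF tendsto_norm[OF flim] _ False])
      show "\<forall>\<^sub>F i in F. norm (?f m i) \<le> c m"
        using ev by eventually_elim (simp add: c(2))
    qed
    \<comment> \<open>By the M-test the block series converges uniformly over the admissible
      indices, which permits exchanging its sum with the limit along \<open>F\<close>.\<close>
    have "uniform_limit ?S (\<lambda>n i. \<Sum>m<n. ?f m i) (\<lambda>i. \<Sum>m. ?f m i) sequentially"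
      using c by (intro Weierstrass_m_test) auto
    then have "((\<lambda>i. \<Sum>m. ?f m i) \<longlongrightarrow> suminf ?g) F"
    proof (rule swap_uniform_limit'[rotated 2])
      show "\<forall>\<^sub>F n in sequentially. ((\<lambda>i. \<Sum>m<n. ?f m i) \<longlongrightarrow> (\<Sum>m<n. ?g m)) F"
        by (intro always_eventually allI tendsto_sum flim)
      show "(\<lambda>n. \<Sum>m<n. ?g m) \<longlonglongrightarrow> suminf ?g"
        by (intro summable_LIMSEQ summable_comparison_test'[OF c(1)] g)
    qed (use ev in simp_all)
    moreover have "\<forall>\<^sub>F i in F. (\<Sum>m. ?f m i) = infsum (multiplier_term a (\<rho> i) \<theta>) UNIV"
      using ev by eventually_elim (simp add: sums_unique[OF sums, symmetric])
    ultimately show ?thesis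
      by (rule Lim_transform_eventually)
  qed simp
qed

lemma weighted_poly_measurable:
  "(\<lambda>\<psi>. ennreal (norm (weighted_poly a F \<psi>))) \<in> borel_measurable torus_measure"
  by (intro measurable_compose[OF _ measurable_ennreal] borel_measurable_torus_measure
      borel_measurable_continuous_onI continuous_on_norm_weighted_poly)

text \<open>Because the blocks have rapidly decreasing energy, the sum of the norms of their weighted
  polynomials is square integrable. Its potential is finite off a set of capacity zero, and it
  dominates all multiplier sums blockwise.\<close>

lemma dirichlet_space_blocks:
  fixes a :: "('n::finite \<Rightarrow> nat) \<Rightarrow> 'h::complex_hilbert_space"
  assumes a: "a \<in> dirichlet_space"
  obtains E and D :: "nat \<Rightarrow> ('n \<Rightarrow> nat) set" and c :: "real ^ 'n \<Rightarrow> nat \<Rightarrow> real"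
  where "E \<subseteq> torus" "capacity E = 0"
    and "\<And>m. finite (D m)" "disjoint_family D" "(\<Union>m. D m) = UNIV"
    and "\<And>\<theta>. \<theta> \<in> torus - E \<Longrightarrow> summable (c \<theta>)"
    and "\<And>\<theta> m \<rho>. \<theta> \<in> torus - E \<Longrightarrow> multiplier \<rho> \<Longrightarrow> norm (sum (multiplier_term a \<rho> \<theta>) (D m)) \<le> c \<theta> m"
proof -
  let ?f = "\<lambda>\<alpha>. weight \<alpha> * (norm (a \<alpha>))\<^sup>2"
  have f: "?f summable_on UNIV"
    using a by (simp add: dirichlet_space_def weight_def)
  \<comment> \<open>The ratio \<open>1 / 8\<close> beats the factor \<open>4 ^ m\<close> from
    \<open>square_suminf_le\<close> and leaves a convergent geometric series.\<close>
  obtain D :: "nat \<Rightarrow> ('n \<Rightarrow> nat) set" where D: "\<And>m. finite (D m)" "disjoint_family D" "(\<Union>m. D m) = UNIV"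
    and small: "\<And>m. sum ?f (D (Suc m)) \<le> (1 / 8) ^ m"
    using finite_blocks_with_small_tails[OF f, of "\<lambda>m. (1 / 8) ^ m"] by auto
  define p where "p m \<psi> = ennreal (norm (weighted_poly a (D m) \<psi>))" for m \<psi>
  define g where "g \<psi> = (\<Sum>m. p m \<psi>)" for \<psi>
  define E where "E = {\<theta>\<in>torus. potential g \<theta> = \<infinity>}"
  define c where "c \<theta> m = enn2real (4 ^ CARD('n) * potential (p m) \<theta>)" for \<theta> m
  have p: "p m \<in> borel_measurable torus_measure" for m
    unfolding p_def by (rule weighted_poly_measurable)
  have g: "g \<in> borel_measurable torus_measure"
    unfolding g_def using p by measurable
  have f0: "0 \<le> sum ?f A" for A
    by (intro sum_nonneg mult_nonneg_nonneg) (simp_all add: weight_pos less_imp_le)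
  have energy: "4 ^ m * (\<integral>\<^sup>+ \<psi>. (p m \<psi>)\<^sup>2 \<partial>torus_measure) = ennreal (4 ^ m * sum ?f (D m))" for m
    unfolding p_def nn_integral_norm_weighted_poly[OF D(1)]
    by (simp add: ennreal_mult f0 ennreal_power[symmetric])
  have "(\<integral>\<^sup>+ \<psi>. (g \<psi>)\<^sup>2 \<partial>torus_measure)
      \<le> (\<integral>\<^sup>+ \<psi>. (\<Sum>m. ennreal ((1 / 4) ^ m)) * (\<Sum>m. 4 ^ m * (p m \<psi>)\<^sup>2) \<partial>torus_measure)"
    unfolding g_def by (intro nn_integral_mono square_suminf_le)
  also have "\<dots> = (\<Sum>m. ennreal ((1 / 4) ^ m)) * (\<Sum>m. ennreal (4 ^ m * sum ?f (D m)))"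
    unfolding energy[symmetric] using p by (simp add: nn_integral_cmult nn_integral_suminf)
  also have "\<dots> < \<infinity>"
  proof -
    \<comment> \<open>The comparison starts at \<open>Suc m\<close> since the energy of
      \<open>D 0\<close> is finite but not small.\<close>
    have bound: "norm (4 ^ Suc m * sum ?f (D (Suc m))) \<le> 4 * (1 / 2) ^ m" for m
    proof -
      have "4 ^ Suc m * sum ?f (D (Suc m)) \<le> 4 ^ Suc m * (1 / 8) ^ m"
        by (intro mult_left_mono small) simp
      also have "\<dots> = 4 * (1 / 2) ^ m"
        by (simp flip: power_mult_distrib)
      finally show ?thesis
        using f0 by simp
    qed
    have "summable (\<lambda>m. 4 * (1 / 2 :: real) ^ m)"
      by (intro summable_mult summable_geometric) simp
    then have "summable (\<lambda>m. 4 ^ Suc m * sum ?f (D (Suc m)))"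
      using bound by (rule summable_comparison_test')
    then have "summable (\<lambda>m. 4 ^ m * sum ?f (D m))"
      by (subst summable_Suc_iff[symmetric])
    then have "(\<Sum>m. ennreal (4 ^ m * sum ?f (D m))) \<noteq> top"
      by (rule ennreal_suminf_neq_top) (intro mult_nonneg_nonneg f0, simp)
    moreover have "(\<Sum>m. ennreal ((1 / 4) ^ m)) \<noteq> top"
      by (rule ennreal_suminf_neq_top) (simp_all add: summable_geometric)
    ultimately show ?thesis
      unfolding infinity_ennreal_def ennreal_mult_less_top less_top by blast
  qed
  finally have "(\<integral>\<^sup>+ \<psi>. (g \<psi>)\<^sup>2 \<partial>torus_measure) < \<infinity>" .
  then have cap: "capacity E = 0"
    unfolding E_def by (rule capacity_potential_infinite[OF g])
  have good: "summable (c \<theta>) \<and> (\<forall>m \<rho>. multiplier \<rho> \<longrightarrow> norm (sum (multiplier_term a \<rho> \<theta>) (D m)) \<le> c \<theta> m)"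
    if "\<theta> \<in> torus - E" for \<theta>
  proof -
    \<comment> \<open>Monotone convergence: the potential of a countable sum of nonnegative
      functions is the sum of the potentials.\<close>
    have "potential g \<theta> = (\<Sum>m. potential (p m) \<theta>)"
      unfolding potential_def g_def ennreal_suminf_cmult[symmetric]
      by (intro nn_integral_suminf borel_measurable_times_ennreal potential_kernel_measurable p)
    moreover have "potential g \<theta> < \<infinity>"
      using that by (simp add: E_def less_top)
    ultimately have "(\<Sum>m. 4 ^ CARD('n) * potential (p m) \<theta>) < \<infinity>"
      by (simp add: ennreal_mult_less_top power_less_top_ennreal)
    then have sum: "(\<Sum>m. 4 ^ CARD('n) * potential (p m) \<theta>) \<noteq> top"
      by simp
    \<comment> \<open>Each term is bounded by the finite total, so \<open>enn2real\<close> in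
      \<open>c\<close> loses nothing at the points off \<open>E\<close>.\<close>
    have pot_eq: "4 ^ CARD('n) * potential (p m) \<theta> = ennreal (c \<theta> m)" for m
    proof -
      have "4 ^ CARD('n) * potential (p m) \<theta> \<le> (\<Sum>m. 4 ^ CARD('n) * potential (p m) \<theta>)"
        using sum_le_suminf[of "\<lambda>m. 4 ^ CARD('n) * potential (p m) \<theta>" "{m}"] by simp
      then show ?thesis
        using sum unfolding c_def by (intro ennreal_enn2real[symmetric]) (metis less_top neq_top_trans)
    qed
    have c0: "0 \<le> c \<theta> m" for m
      by (simp add: c_def)
    have "summable (c \<theta>)"
      using sum unfolding pot_eq by (intro summable_suminf_not_top c0)
    moreover have "norm (sum (multiplier_term a \<rho> \<theta>) (D m)) \<le> c \<theta> m" if "multiplier \<rho>" for \<rho> m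
    proof -
      have "ennreal (norm (sum (multiplier_term a \<rho> \<theta>) (D m))) \<le> ennreal (c \<theta> m)"
        unfolding multiplier_term_def pot_eq[symmetric] p_def
        using that by (intro norm_multiplier_sum_le_potential D) (auto simp: multiplier_def)
      then show ?thesis
        using c0 by simp
    qed
    ultimately show ?thesis
      by blast
  qed
  show thesis
    by (rule that[of E D c]) (use cap D good in \<open>auto simp: E_def\<close>)
qed

section \<open>Dilations and rectangular sums as multiplier sums\<close>

lemma multiplier_power: "r \<in> radii \<Longrightarrow> multiplier (\<lambda>j k. (r $ j) ^ k)"
  unfolding multiplier_def
  by (intro allI conjI antimonoI power_decreasing power_le_one zero_le_power)
    (simp_all add: radii_def less_imp_le)

definition box_multiplier :: "('n \<Rightarrow> nat) \<Rightarrow> 'n \<Rightarrow> nat \<Rightarrow> real"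
  where "box_multiplier N j k = (if k \<le> N j then 1 else 0)"

lemma multiplier_box: "multiplier (box_multiplier N)"
  by (auto simp: multiplier_def box_multiplier_def antimono_def)

text \<open>A product of indicators is the indicator of the box, which is finite, so the unordered
  sum reduces to the rectangular one.\<close>

lemma multiplier_term_box_summable: "multiplier_term a (box_multiplier N) \<theta> summable_on UNIV"
    and rect_partial_sum_eq_infsum: "rect_partial_sum a \<theta> N = infsum (multiplier_term a (box_multiplier N) \<theta>) UNIV"
proof -
  define B where "B = {\<alpha>. \<forall>j. \<alpha> j \<le> N j}"
  have "B = Pi\<^sub>E UNIV (\<lambda>j. {..N j})"
    by (auto simp: B_def PiE_def)
  then have "finite B"
    by (simp add: finite_PiE)
  have B: "multiplier_term a (box_multiplier N) \<theta> \<alpha> = (if \<alpha> \<in> B then character \<alpha> \<theta> *\<^sub>C a \<alpha> else 0)" for \<alpha>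
  proof (cases "\<alpha> \<in> B")
    case False
    then have *: "(\<Prod>j\<in>UNIV. box_multiplier N j (\<alpha> j)) = 0"
      by (intro prod_zero) (auto simp: B_def box_multiplier_def)
    with False show ?thesis
      unfolding multiplier_term_def * by simp
  qed (simp add: B_def box_multiplier_def multiplier_term_def)
  have "(multiplier_term a (box_multiplier N) \<theta> has_sum (\<Sum>\<alpha>\<in>B. multiplier_term a (box_multiplier N) \<theta> \<alpha>)) UNIV"
    by (rule has_sum_finite_neutralI) (use \<open>finite B\<close> B in auto)
  moreover have "(\<Sum>\<alpha>\<in>B. multiplier_term a (box_multiplier N) \<theta> \<alpha>) = rect_partial_sum a \<theta> N"
    unfolding rect_partial_sum_def B_def[symmetric] by (intro sum.cong) (simp_all add: B)
  ultimately show "multiplier_term a (box_multiplier N) \<theta> summable_on UNIV"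
      "rect_partial_sum a \<theta> N = infsum (multiplier_term a (box_multiplier N) \<theta>) UNIV"
    by (auto simp: summable_on_def infsumI)
qed

theorem corollary4:
  fixes a :: "('n::finite \<Rightarrow> nat) \<Rightarrow> 'h::complex_hilbert_space"
  assumes "a \<in> dirichlet_space"
  shows "quasi_everywhere (\<lambda>\<theta>.
           (\<exists>L. ((\<lambda>r. dilation a r \<theta>) \<longlongrightarrow> L) (at 1 within radii)) \<and>
           bdd_above ((\<lambda>r. norm (dilation a r \<theta>)) ` radii)) \<and>
         quasi_everywhere (\<lambda>\<theta>.
           \<exists>L. ((\<lambda>r. dilation a r \<theta>) \<longlongrightarrow> L) (at 1 within radii) \<and> has_pringsheim_sum a \<theta> L)"
proof -
  obtain E D c where E: "E \<subseteq> torus" "capacity E = 0"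
    and D: "\<And>m. finite (D m)" "disjoint_family D" "(\<Union>m. D m) = UNIV"
    and c: "\<And>\<theta>. \<theta> \<in> torus - E \<Longrightarrow> summable (c \<theta>)"
      "\<And>\<theta> m \<rho>. \<theta> \<in> torus - E \<Longrightarrow> multiplier \<rho> \<Longrightarrow> norm (sum (multiplier_term a \<rho> \<theta>) (D m)) \<le> c \<theta> m"
    using dirichlet_space_blocks[OF assms] by metis
  have dil: "dilation a r \<theta> = infsum (multiplier_term a (\<lambda>j k. (r $ j) ^ k) \<theta>) UNIV" for r \<theta>
    unfolding dilation_def multiplier_term_def[abs_def] ..
  have dil_summable: "multiplier_term a (\<lambda>j k. (r $ j) ^ k) \<theta> summable_on UNIV" if "r \<in> radii" for r \<theta>
    using dilation_summable[OF assms that] unfolding multiplier_term_def[abs_def] .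
  \<comment> \<open>One exceptional set and one limit serve all the assertions: \<open>L\<close> is
    the sum of the complete blocks, whichever way the series is approached.\<close>
  have main: "\<exists>L. ((\<lambda>r. dilation a r \<theta>) \<longlongrightarrow> L) (at 1 within radii) \<and>
      bdd_above ((\<lambda>r. norm (dilation a r \<theta>)) ` radii) \<and> has_pringsheim_sum a \<theta> L"
    if \<theta>: "\<theta> \<in> torus - E" for \<theta>
  proof (intro exI conjI)
    note bound = multiplier_infsum_bound_tendsto(1)[OF D c(1)[OF \<theta>] c(2)[OF \<theta>]]
    note lim = multiplier_infsum_bound_tendsto(2)[OF D c(1)[OF \<theta>] c(2)[OF \<theta>]]
    let ?L = "\<Sum>m. \<Sum>\<alpha>\<in>D m. character \<alpha> \<theta> *\<^sub>C a \<alpha>"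
    show "((\<lambda>r. dilation a r \<theta>) \<longlongrightarrow> ?L) (at 1 within radii)"
      unfolding dil
    proof (rule lim)
      show "\<forall>\<^sub>F r in at 1 within radii. multiplier (\<lambda>j k. (r $ j) ^ k)
          \<and> multiplier_term a (\<lambda>j k. (r $ j) ^ k) \<theta> summable_on UNIV"
        unfolding eventually_at_filter
        by (intro always_eventually) (simp add: multiplier_power dil_summable)
      fix j k
      have "((\<lambda>r :: real ^ 'n. (r $ j) ^ k) \<longlongrightarrow> (1 $ j) ^ k) (at 1 within radii)"
        by (intro tendsto_intros)
      then show "((\<lambda>r :: real ^ 'n. (r $ j) ^ k) \<longlongrightarrow> 1) (at 1 within radii)"
        by simp
    qed
    show "bdd_above ((\<lambda>r. norm (dilation a r \<theta>)) ` radii)"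
      unfolding dil by (auto intro!: bdd_aboveI2 bound multiplier_power dil_summable)
    show "has_pringsheim_sum a \<theta> ?L"
      unfolding has_pringsheim_sum_def
    proof
      show "(rect_partial_sum a \<theta> \<longlongrightarrow> ?L) (filtercomap (\<lambda>N. MIN j. N j) at_top)"
        unfolding rect_partial_sum_eq_infsum
      proof (rule lim)
        fix j :: 'n and k :: nat
        \<comment> \<open>Once the smallest side of the box reaches \<open>k\<close>, the multiplier
          at \<open>k\<close> equals 1 in every coordinate, with no relation between the
          sides.\<close>
        have "\<forall>\<^sub>F N in filtercomap (\<lambda>N :: 'n \<Rightarrow> nat. MIN j. N j) at_top. k \<le> (MIN j. N j)"
          by (intro eventually_filtercomapI eventually_ge_at_top)
        then have "\<forall>\<^sub>F N in filtercomap (\<lambda>N :: 'n \<Rightarrow> nat. MIN j. N j) at_top. box_multiplier N j k = 1"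
          by eventually_elim (simp add: box_multiplier_def)
        then show "((\<lambda>N. box_multiplier N j k) \<longlongrightarrow> 1) (filtercomap (\<lambda>N :: 'n \<Rightarrow> nat. MIN j. N j) at_top)"
          by (rule tendsto_eventually)
      qed (simp_all add: multiplier_box multiplier_term_box_summable)
      show "bounded (range (rect_partial_sum a \<theta>))"
        unfolding bounded_iff rect_partial_sum_eq_infsum
        by (rule exI[of _ "suminf (c \<theta>)"])
          (auto intro: bound multiplier_box multiplier_term_box_summable)
    qed
  qed
  have quasi: "quasi_everywhere P" if "\<And>\<theta>. \<theta> \<in> torus - E \<Longrightarrow> P \<theta>" for P
    unfolding quasi_everywhere_def using E that by blast
  show ?thesis
  proof (intro conjI quasi)
    fix \<theta>
    assume "\<theta> \<in> torus - E"
    from main[OF this] obtain L where L: "((\<lambda>r. dilation a r \<theta>) \<longlongrightarrow> L) (at 1 within radii)"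
        "bdd_above ((\<lambda>r. norm (dilation a r \<theta>)) ` radii)" "has_pringsheim_sum a \<theta> L"
      by (elim exE conjE)
    show "\<exists>L. ((\<lambda>r. dilation a r \<theta>) \<longlongrightarrow> L) (at 1 within radii)"
      using L(1) by (rule exI)
    show "bdd_above ((\<lambda>r. norm (dilation a r \<theta>)) ` radii)"
      by (rule L(2))
    show "\<exists>L. ((\<lambda>r. dilation a r \<theta>) \<longlongrightarrow> L) (at 1 within radii) \<and> has_pringsheim_sum a \<theta> L"
      using L(1,3) by (intro exI conjI)
  qed
qed

end
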